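(* Let $n \geq 2$ and let $G := \mathrm{SL}_n(\mathbb{R})$ (with its usual topology). Then the $G$-space $G_c$, i.e. $G$ with the conjugation action $G \times G \to G$, $(g,x) \mapsto gxg^{-1}$, is not reflexively representable.
   Context: All topological spaces are assumed to be Tychonoff. For a topological group $G$, a $G$-space is a topological space $X$ with a continuous action $G \times X \to X$. For a Banach space $V$, $\mathrm{Iso}(V)$ is the topological group of linear isometries of $V$ onto itself with the strong operator topology; it acts on the dual $V^*$ by $(gu^* )(v) = u^*(g^{-1}v)$. A representation of a $G$-space $X$ on $V$ is a pair $(h,\alpha)$ where $h \colon G \to \mathrm{Iso}(V)$ is a continuous homomorphism and $\alpha \colon X \to V^*$ is a norm-bounded, weak-star continuous map that is equivariant: $\alpha(gx) = h(g)\alpha(x)$ for all $g \in G$, $x \in X$. The representation is proper if $\alpha$ is a topological embedding (with $V^*$ carrying the weak-star topology). A $G$-space $X$ is reflexively representable if it admits a proper representation on some reflexive Banach space $V$. *)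

theory Defs
  imports "HOL-Analysis.Analysis" "HOL-Algebra.Group"
begin

section \<open>Topological groups and \<open>G\<close>-spaces\<close>

definition Tychonoff_space :: "'a topology \<Rightarrow> bool" where
  "Tychonoff_space X \<longleftrightarrow> completely_regular_space X \<and> Hausdorff_space X"

locale topological_group = group G
  for G :: "('g, 'm) monoid_scheme" (structure) and TG :: "'g topology" +
  assumes topspace_eq: "topspace TG = carrier G"
    and continuous_mult: "continuous_map (prod_topology TG TG) TG (\<lambda>(x, y). x \<otimes> y)"
    and continuous_inv: "continuous_map TG TG (\<lambda>x. inv x)"
    and Tychonoff_group: "Tychonoff_space TG"

locale G_space = topological_group G TG
  for G :: "('g, 'm) monoid_scheme" (structure) and TG :: "'g topology" +
  fixes X :: "'x topology" and act :: "'g \<Rightarrow> 'x \<Rightarrow> 'x"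
  assumes continuous_act: "continuous_map (prod_topology TG X) X (\<lambda>(g, x). act g x)"
    and act_one: "x \<in> topspace X \<Longrightarrow> act \<one> x = x"
    and act_mult: "g \<in> carrier G \<Longrightarrow> h \<in> carrier G \<Longrightarrow> x \<in> topspace X \<Longrightarrow>
      act (g \<otimes> h) x = act g (act h x)"
    and Tychonoff: "Tychonoff_space X"

definition conj_action :: "('g, 'm) monoid_scheme \<Rightarrow> 'g \<Rightarrow> 'g \<Rightarrow> 'g" where
  "conj_action G g x = g \<otimes>\<^bsub>G\<^esub> x \<otimes>\<^bsub>G\<^esub> inv\<^bsub>G\<^esub> g"

lemma (in topological_group) G_space_conj: "G_space G TG TG (conj_action G)"
proof
  let ?P = "prod_topology TG TG"
  have 1: "continuous_map ?P TG fst" "continuous_map ?P TG snd"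
    by (auto simp: continuous_map_fst continuous_map_snd)
  have m: "continuous_map ?P TG (\<lambda>p. f p \<otimes> g p)"
    if "continuous_map ?P TG f" "continuous_map ?P TG g" for f g
  proof -
    have "continuous_map ?P ?P (\<lambda>p. (f p, g p))"
      using that by (simp add: continuous_map_pairedI)
    from continuous_map_compose[OF this continuous_mult] show ?thesis
      by (simp add: o_def)
  qed
  have i: "continuous_map ?P TG (\<lambda>p. inv (fst p))"
    using continuous_map_compose[OF 1(1) continuous_inv] by (simp add: o_def)
  show "continuous_map ?P TG (\<lambda>(g, x). conj_action G g x)"
    using m[OF m[OF 1] i] by (simp add: conj_action_def case_prod_unfold)
qed (auto simp: topspace_eq conj_action_def inv_mult_group m_assoc Tychonoff_group)

section \<open>Representations on Banach spaces\<close>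

text \<open>
  A real Banach space is a type of class \<^class>\<open>banach\<close>, and its dual \<open>V\<^sup>*\<close> is the type of
  bounded linear functionals with the operator norm.
\<close>

definition bidual_embedding :: "'v::real_normed_vector \<Rightarrow> (('v \<Rightarrow>\<^sub>L real) \<Rightarrow>\<^sub>L real)" where
  "bidual_embedding v = Blinfun (\<lambda>u. blinfun_apply u v)"

lemma bidual_embedding_apply [simp]:
  "blinfun_apply (bidual_embedding v) u = blinfun_apply u v"
  unfolding bidual_embedding_def
  by (simp add: bounded_linear_Blinfun_apply blinfun.bounded_linear_left)

definition reflexive_space :: "'v::banach itself \<Rightarrow> bool" where
  "reflexive_space _ \<longleftrightarrow> surj (bidual_embedding :: 'v \<Rightarrow> ('v \<Rightarrow>\<^sub>L real) \<Rightarrow>\<^sub>L real)"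

definition Iso_group :: "('v::banach \<Rightarrow>\<^sub>L 'v) monoid" where
  "Iso_group = \<lparr>carrier = {T. (\<forall>v. norm (blinfun_apply T v) = norm v) \<and> surj (blinfun_apply T)},
     monoid.mult = (o\<^sub>L), one = id_blinfun\<rparr>"

definition Iso_topology :: "('v::banach \<Rightarrow>\<^sub>L 'v) topology" where
  "Iso_topology = subtopology strong_operator_topology (carrier Iso_group)"

text \<open>
  On operators into the scalars, the topology of pointwise convergence is the weak-star topology.
\<close>
definition weak_star_topology :: "('v::banach \<Rightarrow>\<^sub>L real) topology" where
  "weak_star_topology = strong_operator_topology"

definition dual_action :: "('v::banach \<Rightarrow>\<^sub>L 'v) \<Rightarrow> ('v \<Rightarrow>\<^sub>L real) \<Rightarrow> ('v \<Rightarrow>\<^sub>L real)" where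
  "dual_action T u = u o\<^sub>L inv\<^bsub>Iso_group\<^esub> T"

lemma group_Iso_group: "group (Iso_group :: ('v::banach \<Rightarrow>\<^sub>L 'v) monoid)"
proof (rule groupI)
  fix T :: "'v \<Rightarrow>\<^sub>L 'v" assume T: "T \<in> carrier Iso_group"
  then have n: "norm (T v) = norm v" and s: "surj (blinfun_apply T)" for v
    by (auto simp: Iso_group_def)
  have i: "inj (blinfun_apply T)"
    by (rule injI) (metis blinfun.diff_right eq_iff_diff_eq_0 n norm_eq_zero)
  define S where "S = inv_into UNIV (blinfun_apply T)"
  have TS: "T (S v) = v" and ST: "S (T v) = v" for v
    by (simp_all add: S_def s surj_f_inv_f i)
  have S: "bounded_linear S"
  proof (rule bounded_linear_intro[where K = 1])
    show "S (x + y) = S x + S y" for x y by (metis TS ST blinfun.add_right)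
    show "S (r *\<^sub>R x) = r *\<^sub>R S x" for r x by (metis TS ST blinfun.scaleR_right)
    show "norm (S x) \<le> norm x * 1" for x by (metis TS n mult.right_neutral order_refl)
  qed
  have "norm (S v) = norm v" for v by (metis TS n)
  moreover have "surj S" using ST by (rule surjI)
  ultimately have "Blinfun S \<in> carrier Iso_group"
    using S by (simp add: Iso_group_def bounded_linear_Blinfun_apply)
  moreover have "Blinfun S \<otimes>\<^bsub>Iso_group\<^esub> T = \<one>\<^bsub>Iso_group\<^esub>"
    using S by (auto simp: Iso_group_def bounded_linear_Blinfun_apply ST intro!: blinfun_eqI)
  ultimately show "\<exists>S\<in>carrier Iso_group. S \<otimes>\<^bsub>Iso_group\<^esub> T = \<one>\<^bsub>Iso_group\<^esub>" by blast
next
  fix S T :: "'v \<Rightarrow>\<^sub>L 'v" assume "S \<in> carrier Iso_group" "T \<in> carrier Iso_group"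
  then show "S \<otimes>\<^bsub>Iso_group\<^esub> T \<in> carrier Iso_group"
    using comp_surj[of "blinfun_apply T" "blinfun_apply S"] by (simp add: Iso_group_def o_def)
next
  show "\<one>\<^bsub>Iso_group\<^esub> \<in> carrier (Iso_group :: ('v \<Rightarrow>\<^sub>L 'v) monoid)"
    by (auto simp: Iso_group_def surj_def)
qed (auto simp: Iso_group_def intro!: blinfun_eqI)

definition is_representation ::
  "('g, 'm) monoid_scheme \<Rightarrow> 'g topology \<Rightarrow> 'x topology \<Rightarrow> ('g \<Rightarrow> 'x \<Rightarrow> 'x) \<Rightarrow>
   ('g \<Rightarrow> ('v::banach \<Rightarrow>\<^sub>L 'v)) \<Rightarrow> ('x \<Rightarrow> ('v \<Rightarrow>\<^sub>L real)) \<Rightarrow> bool" where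
  "is_representation G TG X act h \<alpha> \<longleftrightarrow>
     h \<in> hom G Iso_group \<and> continuous_map TG Iso_topology h \<and>
     bounded (\<alpha> ` topspace X) \<and> continuous_map X weak_star_topology \<alpha> \<and>
     (\<forall>g\<in>carrier G. \<forall>x\<in>topspace X. \<alpha> (act g x) = dual_action (h g) (\<alpha> x))"

definition is_proper_representation ::
  "('g, 'm) monoid_scheme \<Rightarrow> 'g topology \<Rightarrow> 'x topology \<Rightarrow> ('g \<Rightarrow> 'x \<Rightarrow> 'x) \<Rightarrow>
   ('g \<Rightarrow> ('v::banach \<Rightarrow>\<^sub>L 'v)) \<Rightarrow> ('x \<Rightarrow> ('v \<Rightarrow>\<^sub>L real)) \<Rightarrow> bool" where
  "is_proper_representation G TG X act h \<alpha> \<longleftrightarrow>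
     is_representation G TG X act h \<alpha> \<and> embedding_map X weak_star_topology \<alpha>"

text \<open>
  HOL has no quantifier over types, so the Banach space is a type parameter of the following
  predicate: a \<open>G\<close>-space is reflexively representable iff the predicate holds for some \<open>'v\<close>.
  A theorem negating it for an arbitrary type variable \<open>'v\<close> thus denies reflexive representability.
\<close>
definition reflexively_representable_on ::
  "'v::banach itself \<Rightarrow> ('g, 'm) monoid_scheme \<Rightarrow> 'g topology \<Rightarrow> 'x topology \<Rightarrow>
   ('g \<Rightarrow> 'x \<Rightarrow> 'x) \<Rightarrow> bool" where
  "reflexively_representable_on V G TG X act \<longleftrightarrow>
     reflexive_space V \<and>
     (\<exists>(h :: 'g \<Rightarrow> ('v \<Rightarrow>\<^sub>L 'v)) (\<alpha> :: 'x \<Rightarrow> ('v \<Rightarrow>\<^sub>L real)).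
        is_proper_representation G TG X act h \<alpha>)"

section \<open>The special linear group\<close>

definition SL_group :: "(real^'n^'n) monoid" where
  "SL_group = \<lparr>carrier = {A. det A = 1}, monoid.mult = (**), one = mat 1\<rparr>"

definition SL_topology :: "(real^'n^'n) topology" where
  "SL_topology = top_of_set (carrier SL_group)"

lemma group_SL_group: "group (SL_group :: (real^'n^'n) monoid)"
proof (rule groupI)
  fix A :: "real^'n^'n" assume "A \<in> carrier SL_group"
  then have "det A = 1" by (simp add: SL_group_def)
  then obtain B where B: "B ** A = mat 1"
    by (metis invertible_det_nz invertible_def zero_neq_one)
  with \<open>det A = 1\<close> have "det B = 1"
    by (metis det_I det_mul mult.right_neutral)
  with B show "\<exists>B\<in>carrier SL_group. B \<otimes>\<^bsub>SL_group\<^esub> A = \<one>\<^bsub>SL_group\<^esub>"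
    by (auto simp: SL_group_def)
qed (auto simp: SL_group_def det_mul matrix_mul_assoc)

lemma SL_inv_entry:
  fixes A :: "real^'n^'n"
  assumes "A \<in> carrier SL_group"
  shows "inv\<^bsub>SL_group\<^esub> A = (\<chi> k j. det (\<chi> i l. if l = k then axis j 1 $ i else A $ i $ l))"
proof -
  interpret group "SL_group :: (real^'n^'n) monoid" by (rule group_SL_group)
  let ?B = "inv\<^bsub>SL_group\<^esub> A"
  have d: "det A = 1" using assms by (simp add: SL_group_def)
  have AB: "A ** ?B = mat 1" using r_inv[OF assms] by (simp add: SL_group_def)
  have "?B $ k $ j = det (\<chi> i l. if l = k then axis j 1 $ i else A $ i $ l)" for k j
  proof -
    have "A *v (column j ?B) = axis j 1"
      by (metis AB matrix_vector_mul_assoc matrix_vector_mul_lid matrix_vector_mult_basis)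
    then have "column j ?B = (\<chi> k. det (\<chi> i l. if l = k then axis j 1 $ i else A $ i $ l) / det A)"
      using cramer[of A "column j ?B" "axis j 1"] d by simp
    then show ?thesis by (simp add: d column_def vec_eq_iff)
  qed
  then show ?thesis by (simp add: vec_eq_iff)
qed

lemma topological_group_SL: "topological_group (SL_group :: (real^'n^'n) monoid) SL_topology"
proof -
  interpret group "SL_group :: (real^'n^'n) monoid" by (rule group_SL_group)
  let ?S = "carrier SL_group :: (real^'n^'n) set"
  show ?thesis
  proof
    show "topspace SL_topology = ?S" by (simp add: SL_topology_def)
    have P: "prod_topology (top_of_set ?S) (top_of_set ?S) = top_of_set (?S \<times> ?S)"
      by (rule prod_topology_subtopology_eu)
    have "continuous_on (?S \<times> ?S) (\<lambda>p. fst p ** snd p)"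
      unfolding matrix_matrix_mult_def by (intro continuous_intros)
    moreover have "fst p ** snd p \<in> ?S" if "p \<in> ?S \<times> ?S" for p
      using that by (auto simp: SL_group_def det_mul)
    ultimately have "continuous_map (top_of_set (?S \<times> ?S)) (top_of_set ?S) (\<lambda>p. fst p ** snd p)"
      by auto
    then show "continuous_map (prod_topology SL_topology SL_topology) SL_topology
        (\<lambda>(x, y). x \<otimes>\<^bsub>SL_group\<^esub> y :: real^'n^'n)"
      unfolding SL_topology_def P case_prod_unfold by (simp add: SL_group_def)
    have c: "continuous_on ?S (\<lambda>A. if l = k then (axis j 1 :: real^'n) $ i else A $ i $ l)" for i j k l
      by (cases "l = k") (auto intro!: continuous_intros)
    have "continuous_on ?S (\<lambda>A. \<chi> k j. det (\<chi> i l. if l = k then axis j 1 $ i else A $ i $ l))"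
      unfolding det_def by (intro continuous_intros) (simp add: c)
    then have "continuous_on ?S (\<lambda>A. inv\<^bsub>SL_group\<^esub> A)"
      by (rule continuous_on_eq) (simp add: SL_inv_entry)
    then show "continuous_map SL_topology SL_topology (\<lambda>A :: real^'n^'n. inv\<^bsub>SL_group\<^esub> A)"
      by (auto simp: SL_topology_def)
    show "Tychonoff_space (SL_topology :: (real^'n^'n) topology)"
      by (simp add: Tychonoff_space_def SL_topology_def Hausdorff_space_subtopology
          completely_regular_space_subtopology metrizable_imp_completely_regular_space
          metrizable_space_euclidean)
  qed
qed

lemma G_space_SL_conj:
  "G_space (SL_group :: (real^'n^'n) monoid) SL_topology SL_topology (conj_action SL_group)"
  by (rule topological_group.G_space_conj[OF topological_group_SL])

end

theory Submission
  imports Defs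
begin

text \<open>
  Let \<open>w\<close> be the transvection \<open>1 + E\<^sub>i\<^sub>j\<close>, \<open>w\<^sup>m = 1 + m E\<^sub>i\<^sub>j\<close> and \<open>x\<^sub>m = 1 - E\<^sub>j\<^sub>i / m\<^sup>2\<close>.  Then \<open>x\<^sub>m\<close> tends to
  \<open>1\<close>, but \<open>w\<^sup>m x\<^sub>m w\<^sup>-\<^sup>m\<close> tends to \<open>w\<close>.  Given a proper representation \<open>(h, \<alpha>)\<close> on a reflexive
  space, the nonzero functional \<open>\<alpha>(w) - \<alpha>(1)\<close> is fixed by \<open>h(w)\<close>, because \<open>w\<close> commutes with \<open>w\<close>
  and \<open>1\<close>.  By a mean ergodic argument some \<open>h(w)\<close>-fixed vector \<open>v\<close> is not annihilated by it.
  Pairing \<open>\<alpha>(x\<^sub>m)\<close> and \<open>\<alpha>(w\<^sup>m x\<^sub>m w\<^sup>-\<^sup>m)\<close> with \<open>v\<close> gives the same number, so in the limit \<open>\<alpha>(1)\<close> and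
  \<open>\<alpha>(w)\<close> agree on \<open>v\<close>, a contradiction.
\<close>

section \<open>Fixed vectors in reflexive spaces\<close>

text \<open>Evaluation at all functionals places the sequence in a product of compact intervals,
  where Tychonoff's theorem gives a cluster point; reflexivity represents that point by a vector. A
  filter \<open>F\<close> finer than \<open>sequentially\<close> stands in for a subsequence, as the
  product need not be sequentially compact.\<close>

lemma reflexive_bounded_sequence_weak_cluster:
  fixes a :: "nat \<Rightarrow> 'v::banach"
  assumes refl: "reflexive_space TYPE('v)" and bdd: "\<And>n. norm (a n) \<le> C"
  obtains F v where "F \<le> sequentially" "F \<noteq> bot"
    "\<And>\<psi> :: 'v \<Rightarrow>\<^sub>L real. ((\<lambda>n. \<psi> (a n)) \<longlongrightarrow> \<psi> v) F"
proof -
  define S where "S = PiE UNIV (\<lambda>\<psi> :: 'v \<Rightarrow>\<^sub>L real. cball (0::real) (norm \<psi> * C))"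
  define p where "p n = (\<lambda>\<psi> :: 'v \<Rightarrow>\<^sub>L real. \<psi> (a n))" for n
  have bound: "\<bar>\<psi> (a n)\<bar> \<le> norm \<psi> * C" for \<psi> :: "'v \<Rightarrow>\<^sub>L real" and n
    using norm_blinfun[of \<psi> "a n"] mult_left_mono[OF bdd[of n], of "norm \<psi>"] by simp
  have "compactin (product_topology (\<lambda>\<psi> :: 'v \<Rightarrow>\<^sub>L real. euclidean) UNIV) S"
    unfolding S_def by (subst compactin_PiE) auto
  then have "compact S"
    by (simp add: euclidean_product_topology)
  moreover have "filtermap p sequentially \<noteq> bot"
    by (simp add: filtermap_bot_iff)
  moreover have "eventually (\<lambda>x. x \<in> S) (filtermap p sequentially)"
    unfolding eventually_filtermap S_def p_def
    by (rule always_eventually) (simp add: bound PiE_UNIV_domain)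
  ultimately obtain \<Lambda> where \<Lambda>: "inf (nhds \<Lambda>) (filtermap p sequentially) \<noteq> bot"
    unfolding compact_filter by blast
  \<comment> \<open>Pulling back the neighbourhoods of the cluster point makes \<open>p\<close>
    converge to it along \<open>F\<close>; clustering is what keeps \<open>F\<close> proper.\<close>
  define F where "F = inf sequentially (filtercomap p (nhds \<Lambda>))"
  have F: "F \<le> sequentially" by (simp add: F_def)
  have nb: "F \<noteq> bot"
  proof
    assume "F = bot"
    then obtain P Q where "eventually P sequentially" "eventually Q (nhds \<Lambda>)"
        and PQ: "\<And>n. P n \<Longrightarrow> Q (p n) \<Longrightarrow> False"
      unfolding F_def trivial_limit_def eventually_inf eventually_filtercomap by blast
    then have "eventually (\<lambda>x. \<not> Q x) (filtermap p sequentially)"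
      unfolding eventually_filtermap by (auto elim: eventually_mono dest: PQ)
    then have "eventually (\<lambda>x. \<not> Q x) (inf (nhds \<Lambda>) (filtermap p sequentially))"
      by (rule filter_leD[OF inf_le2])
    moreover have "eventually Q (inf (nhds \<Lambda>) (filtermap p sequentially))"
      using \<open>eventually Q (nhds \<Lambda>)\<close> by (rule filter_leD[OF inf_le1])
    ultimately have "eventually (\<lambda>_. False) (inf (nhds \<Lambda>) (filtermap p sequentially))"
      by eventually_elim simp
    with \<Lambda> show False by (simp add: trivial_limit_def)
  qed
  have "filterlim p (nhds \<Lambda>) F"
    unfolding filterlim_iff_le_filtercomap F_def by simp
  then have lim: "((\<lambda>n. \<psi> (a n)) \<longlongrightarrow> \<Lambda> \<psi>) F" for \<psi> :: "'v \<Rightarrow>\<^sub>L real"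
    using continuous_on_tendsto_compose[of UNIV "\<lambda>x. x \<psi>" p \<Lambda> F] by (simp add: p_def)
  \<comment> \<open>Linearity and the norm bound pass to the pointwise limit, so \<Lambda> lies in
    the bidual.\<close>
  have "bounded_linear \<Lambda>"
  proof (rule bounded_linear_intro[where K = C])
    fix \<psi> \<theta> :: "'v \<Rightarrow>\<^sub>L real" and r :: real
    show "\<Lambda> (\<psi> + \<theta>) = \<Lambda> \<psi> + \<Lambda> \<theta>"
      using tendsto_unique[OF nb lim[of "\<psi> + \<theta>"]] tendsto_add[OF lim lim, of \<psi> \<theta>]
      by (simp add: blinfun.add_left)
    show "\<Lambda> (r *\<^sub>R \<psi>) = r *\<^sub>R \<Lambda> \<psi>"
      using tendsto_unique[OF nb lim[of "r *\<^sub>R \<psi>"]] tendsto_scaleR[OF tendsto_const lim, of r \<psi>]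
      by (simp add: blinfun.scaleR_left)
    show "norm (\<Lambda> \<psi>) \<le> norm \<psi> * C"
      by (rule tendsto_upperbound[OF tendsto_norm[OF lim] _ nb]) (simp add: bound)
  qed
  moreover obtain v where "Blinfun \<Lambda> = bidual_embedding v"
    using refl unfolding reflexive_space_def by (metis surjD)
  ultimately have "\<Lambda> \<psi> = \<psi> v" for \<psi>
    by (metis bidual_embedding_apply bounded_linear_Blinfun_apply)
  with F nb lim show thesis by (metis that)
qed

text \<open>
  The vector is a weak cluster point of the Cesaro means of an orbit.  Invariance is stated through
  functionals, so that no Hahn--Banach theorem is needed.
\<close>
lemma reflexive_fixed_vector_not_annihilated:
  fixes T :: "'v::banach \<Rightarrow>\<^sub>L 'v" and \<phi> :: "'v \<Rightarrow>\<^sub>L real"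
  assumes refl: "reflexive_space TYPE('v)" and T: "\<And>x. norm (T x) \<le> norm x"
    and \<phi>: "\<And>x. \<phi> (T x) = \<phi> x" "\<phi> \<noteq> 0"
  obtains v where "\<phi> v \<noteq> 0" "\<And>\<psi> :: 'v \<Rightarrow>\<^sub>L real. \<psi> (T v) = \<psi> v"
proof -
  obtain v0 where v0: "\<phi> v0 \<noteq> 0"
    using \<phi>(2) by (metis blinfun_eqI zero_blinfun.rep_eq)
  define orb where "orb k = (blinfun_apply T ^^ k) v0" for k
  define a where "a n = (1 / real n) *\<^sub>R (\<Sum>k<n. orb k)" for n
  have no: "norm (orb k) \<le> norm v0" for k
    by (induction k) (auto simp: orb_def intro: order_trans[OF T])
  have \<phi>o: "\<phi> (orb k) = \<phi> v0" for k
    by (induction k) (auto simp: orb_def \<phi>(1))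
  have "norm (\<Sum>k<n. orb k) \<le> real n * norm v0" for n
    using sum_norm_le[of "{..<n}" orb "\<lambda>_. norm v0"] no by simp
  then have "norm (a n) \<le> norm v0" for n
    by (cases "n = 0") (auto simp: a_def field_simps)
  then obtain F v where F: "F \<le> sequentially" "F \<noteq> bot"
    and lim: "\<And>\<psi> :: 'v \<Rightarrow>\<^sub>L real. ((\<lambda>n. \<psi> (a n)) \<longlongrightarrow> \<psi> v) F"
    using reflexive_bounded_sequence_weak_cluster[OF refl] by metis
  show thesis
  proof
    \<comment> \<open>At \<open>n = 0\<close> the mean is an empty sum, so \<phi> takes the value
      \<open>\<phi> v0\<close> on \<open>a n\<close> only for positive \<open>n\<close>.\<close>
    have "eventually (\<lambda>n. n > 0) F"
      using F(1) eventually_gt_at_top le_filter_def by blast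
    then have "eventually (\<lambda>n. \<phi> (a n) = \<phi> v0) F"
      by eventually_elim (simp add: a_def blinfun.scaleR_right blinfun.sum_right \<phi>o)
    then have "((\<lambda>n. \<phi> (a n)) \<longlongrightarrow> \<phi> v0) F"
      by (rule tendsto_eventually)
    with v0 show "\<phi> v \<noteq> 0"
      using tendsto_unique[OF F(2) lim] by metis
  next
    fix \<psi> :: "'v \<Rightarrow>\<^sub>L real"
    \<comment> \<open>The sum telescopes because \<open>T\<close> shifts the orbit; thus
      \<open>T\<close> moves the \<open>n\<close>-th mean by O(1/n) in norm.\<close>
    have "T (\<Sum>k<n. orb k) - (\<Sum>k<n. orb k) = orb n - v0" for n
      by (induction n) (auto simp: orb_def blinfun.add_right blinfun.zero_right algebra_simps)
    then have "T (a n) - a n = (1 / real n) *\<^sub>R (orb n - v0)" for n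
      by (simp add: a_def blinfun.scaleR_right flip: scaleR_diff_right)
    then have eq: "\<psi> (T (a n)) - \<psi> (a n) = \<psi> (orb n - v0) / real n" for n
      by (metis blinfun.diff_right blinfun.scaleR_right divide_inverse inverse_eq_divide
          mult.commute real_scaleR_def)
    have "norm (\<psi> (orb n - v0)) \<le> norm \<psi> * (2 * norm v0)" for n
    proof -
      have "norm (orb n - v0) \<le> 2 * norm v0"
        using norm_triangle_ineq4[of "orb n" v0] no[of n] by simp
      then show ?thesis
        using norm_blinfun[of \<psi> "orb n - v0"] mult_left_mono[of _ _ "norm \<psi>"] by fastforce
    qed
    then have "norm (\<psi> (orb n - v0) / real n) \<le> norm \<psi> * (2 * norm v0) / real n" for n
      by (simp add: divide_right_mono)
    then have "(\<lambda>n. \<psi> (orb n - v0) / real n) \<longlonglongrightarrow> 0"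
      by (intro Lim_null_comparison[OF always_eventually lim_const_over_n]) blast
    then have "((\<lambda>n. \<psi> (T (a n)) - \<psi> (a n)) \<longlongrightarrow> 0) F"
      unfolding eq using F(1) by (rule filterlim_mono[OF _ order_refl])
    \<comment> \<open>Weak convergence also applies to the functional
      \<open>\<psi> o\<^sub>L T\<close>.\<close>
    moreover have "((\<lambda>n. \<psi> (T (a n)) - \<psi> (a n)) \<longlongrightarrow> \<psi> (T v) - \<psi> v) F"
      using tendsto_diff[OF lim[of "\<psi> o\<^sub>L T"] lim[of \<psi>]] by simp
    ultimately show "\<psi> (T v) = \<psi> v"
      using tendsto_unique[OF F(2)] by fastforce
  qed
qed

section \<open>Transvections\<close>

text \<open>For \<open>i = j\<close> this is a diagonal matrix rather than a transvection, hence the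
  assumption \<open>i \<noteq> j\<close> in the multiplicative facts below.\<close>

definition transvection :: "'n \<Rightarrow> 'n \<Rightarrow> 'a \<Rightarrow> 'a::comm_ring_1^'n^'n" where
  "transvection i j c = (\<chi> r s. (if r = s then 1 else 0) + (if r = i \<and> s = j then c else 0))"

lemma transvection_0: "transvection i j 0 = mat 1"
  by (simp add: transvection_def mat_def vec_eq_iff)

lemma transvection_mult_nth:
  "(transvection i j c ** A) $ r $ s = A $ r $ s + (if r = i then c * A $ j $ s else 0)"
proof -
  \<comment> \<open>Each summand is split into two terms supported at a single index, so both sums
    collapse.\<close>
  have "(transvection i j c ** A) $ r $ s =
      (\<Sum>k\<in>UNIV. (if k = r then A $ r $ s else 0) + (if k = j then if r = i then c * A $ j $ s else 0 else 0))"
    unfolding transvection_def matrix_matrix_mult_def vec_lambda_beta by (rule sum.cong) (auto simp: algebra_simps)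
  then show ?thesis by (simp add: sum.distrib)
qed

lemma mult_transvection_nth:
  "(A ** transvection i j c) $ r $ s = A $ r $ s + (if s = j then A $ r $ i * c else 0)"
proof -
  have "(A ** transvection i j c) $ r $ s =
      (\<Sum>k\<in>UNIV. (if k = s then A $ r $ s else 0) + (if k = i then if s = j then A $ r $ i * c else 0 else 0))"
    unfolding transvection_def matrix_matrix_mult_def vec_lambda_beta by (rule sum.cong) (auto simp: algebra_simps)
  then show ?thesis by (simp add: sum.distrib)
qed

lemma transvection_mult:
  assumes "i \<noteq> j"
  shows "transvection i j c ** transvection i j d = transvection i j (c + d)"
  using assms by (auto simp: vec_eq_iff transvection_mult_nth) (auto simp: transvection_def)

lemma det_transvection:
  assumes "i \<noteq> j"
  shows "det (transvection i j c) = 1"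
proof -
  have "transvection i j c = (\<chi> k. if k = i then row i (mat 1) + c *s row j (mat 1) else row k (mat 1))"
    by (auto simp: vec_eq_iff transvection_def row_def mat_def)
  then show ?thesis
    using det_row_operation[OF assms, of "mat 1" c] by simp
qed

lemma transvection_in_SL:
  "i \<noteq> j \<Longrightarrow> transvection i j c \<in> carrier SL_group"
  by (simp add: SL_group_def det_transvection)

lemma SL_inv_transvection:
  assumes "i \<noteq> j"
  shows "inv\<^bsub>SL_group\<^esub> (transvection i j c) = transvection i j (- c)"
proof (rule group.inv_equality[OF group_SL_group])
  show "transvection i j (- c) \<otimes>\<^bsub>SL_group\<^esub> transvection i j c = \<one>\<^bsub>SL_group\<^esub>"
    using assms by (simp add: SL_group_def transvection_mult transvection_0)
qed (use assms in \<open>auto simp: transvection_in_SL\<close>)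

lemma conj_transvection:
  assumes "i \<noteq> j"
  shows "conj_action SL_group (transvection i j c) A =
    transvection i j c ** A ** transvection i j (- c)"
  by (simp add: conj_action_def SL_inv_transvection assms) (simp add: SL_group_def)

lemma tendsto_opposite_transvection:
  "(\<lambda>m. transvection j i (- (inverse (real (Suc m)))\<^sup>2)) \<longlonglongrightarrow> mat 1"
proof (intro vec_tendstoI)
  fix r s
  have "(\<lambda>m. - (inverse (real (Suc m)))\<^sup>2) \<longlonglongrightarrow> - 0\<^sup>2"
    by (intro tendsto_intros LIMSEQ_inverse_real_of_nat)
  then have "(\<lambda>m. mat 1 $ r $ s + (if r = j \<and> s = i then - (inverse (real (Suc m)))\<^sup>2 else 0))
      \<longlonglongrightarrow> mat 1 $ r $ s + 0"
    by (intro tendsto_add tendsto_const) (cases "r = j"; cases "s = i"; simp)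
  then show "(\<lambda>m. transvection j i (- (inverse (real (Suc m)))\<^sup>2) $ r $ s) \<longlonglongrightarrow> mat 1 $ r $ s"
    by (cases "r = s") (simp_all add: transvection_def mat_def del: of_nat_Suc)
qed

text \<open>With \<open>q = 1 / Suc m\<close>, conjugating \<open>1 - q^2 E_ji\<close> yields
  \<open>1 + E_ij - q^2 E_ji - q E_ii + q E_jj\<close>. The two factors \<open>Suc m\<close>
  contributed by the conjugation cancel \<open>q^2\<close> in the \<open>E_ij\<close> coefficient,
  while the remaining corrections vanish in the limit.\<close>

lemma tendsto_conj_opposite_transvection:
  assumes "i \<noteq> j"
  shows "(\<lambda>m. conj_action SL_group (transvection i j (real (Suc m)))
      (transvection j i (- (inverse (real (Suc m)))\<^sup>2))) \<longlonglongrightarrow> transvection i j 1"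
proof (intro vec_tendstoI)
  fix r s
  define q where "q m = inverse (real (Suc m))" for m
  have q: "q \<longlonglongrightarrow> 0"
    unfolding q_def by (rule LIMSEQ_inverse_real_of_nat)
  have mq: "real (Suc m) * q m = 1" for m by (simp add: q_def)
  have "(conj_action SL_group (transvection i j (real (Suc m))) (transvection j i (- (q m)\<^sup>2))) $ r $ s
     = transvection i j 1 $ r $ s
       + (if r = j \<and> s = i then - (q m)\<^sup>2 else if r = i \<and> s = i then - q m
          else if r = j \<and> s = j then q m else 0)" for m
  proof -
    have 1: "real (Suc m) * (q m)\<^sup>2 = q m" using mq[of m] by (simp add: power2_eq_square flip: mult.assoc)
    have 2: "(q m)\<^sup>2 * real (Suc m) = q m" using 1 by (simp add: mult.commute)
    have 3: "real (Suc m) * (q m)\<^sup>2 * real (Suc m) = 1" using 1 mq[of m] by (simp add: mult.commute)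
    show ?thesis
      using assms 1 2 3 unfolding conj_transvection[OF assms] mult_transvection_nth transvection_mult_nth
      by (auto simp: transvection_def algebra_simps simp del: of_nat_Suc)
  qed
  moreover have "(\<lambda>m. transvection i j 1 $ r $ s
       + (if r = j \<and> s = i then - (q m)\<^sup>2 else if r = i \<and> s = i then - q m
          else if r = j \<and> s = j then q m else 0)) \<longlonglongrightarrow> transvection i j 1 $ r $ s"
    by (cases "r = j"; cases "s = i"; cases "r = i"; cases "s = j") (auto intro!: tendsto_eq_intros q)
  ultimately show "(\<lambda>m. conj_action SL_group (transvection i j (real (Suc m)))
      (transvection j i (- (inverse (real (Suc m)))\<^sup>2)) $ r $ s) \<longlonglongrightarrow> transvection i j 1 $ r $ s"
    by (simp add: q_def)
qed

section \<open>The conjugation action\<close>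

theorem theorem3p3:
  assumes "CARD('n::finite) \<ge> 2"
  shows "\<not> reflexively_representable_on TYPE('v::banach)
    (SL_group :: (real^'n^'n) monoid) SL_topology SL_topology (conj_action SL_group)"
proof
  let ?G = "SL_group :: (real^'n^'n) monoid"
  let ?c = "conj_action ?G"
  assume "reflexively_representable_on TYPE('v) ?G SL_topology SL_topology ?c"
  then obtain h :: "real^'n^'n \<Rightarrow> ('v \<Rightarrow>\<^sub>L 'v)" and \<alpha> :: "real^'n^'n \<Rightarrow> ('v \<Rightarrow>\<^sub>L real)"
    where refl: "reflexive_space TYPE('v)"
      and rep: "is_representation ?G SL_topology SL_topology ?c h \<alpha>"
      and emb: "embedding_map SL_topology weak_star_topology \<alpha>"
    unfolding reflexively_representable_on_def is_proper_representation_def by blast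
  interpret G: G_space ?G SL_topology SL_topology ?c
    by (rule G_space_SL_conj)
  have top: "topspace SL_topology = carrier ?G"
    by (rule G.topspace_eq)
  have equiv: "\<alpha> (?c g x) = \<alpha> x o\<^sub>L inv\<^bsub>Iso_group\<^esub> (h g)"
    if "g \<in> carrier ?G" "x \<in> carrier ?G" for g x
    using rep that by (simp add: is_representation_def dual_action_def top)
  have "\<exists>i j :: 'n. i \<noteq> j"
    using assms card_le_Suc0_iff_eq[of "UNIV :: 'n set"] by auto
  then obtain i j :: 'n where ij: "i \<noteq> j" by blast
  let ?t = "transvection i j :: real \<Rightarrow> _"
  let ?x = "\<lambda>m. transvection j i (- (inverse (real (Suc m)))\<^sup>2)"
  have t: "?t c \<in> carrier ?G" and x: "?x m \<in> carrier ?G" for c m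
    using ij by (simp_all add: transvection_in_SL)
  have conj_in: "?c g x \<in> carrier ?G" if "g \<in> carrier ?G" "x \<in> carrier ?G" for g x
    using that by (simp add: conj_action_def)
  have one: "mat 1 \<in> carrier ?G" by (simp add: SL_group_def)
  \<comment> \<open>The dual action precomposes with the inverse isometry, so conjugation by
    \<open>?t 1\<close> acts on values of \<alpha> as precomposition with \<open>T\<close>.\<close>
  define T where "T = inv\<^bsub>Iso_group\<^esub> (h (?t 1))"
  have "h (?t 1) \<in> carrier Iso_group"
    using rep t by (auto simp: is_representation_def hom_def)
  then have "T \<in> carrier Iso_group"
    unfolding T_def by (rule group.inv_closed[OF group_Iso_group])
  then have T: "norm (T u) = norm u" for u
    by (simp add: Iso_group_def)
  have \<alpha>T: "\<alpha> (?c (?t 1) y) u = \<alpha> y (T u)" if "y \<in> carrier ?G" for y u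
    using equiv[OF t that] by (simp add: T_def)
  define \<phi> where "\<phi> = \<alpha> (?t 1) - \<alpha> (mat 1)"
  have "?c (?t 1) (?t 1) = ?t 1" "?c (?t 1) (mat 1) = mat 1"
    using ij by (simp_all add: conj_transvection transvection_mult transvection_0)
  then have \<phi>T: "\<phi> (T u) = \<phi> u" for u
    using \<alpha>T[OF t, of 1 u] \<alpha>T[OF one, of u] by (simp add: \<phi>_def blinfun.diff_left)
  \<comment> \<open>Properness enters here: \<alpha> separates \<open>?t 1\<close> from the
    identity.\<close>
  have "inj_on \<alpha> (carrier ?G)"
    using emb by (simp add: embedding_map_def homeomorphic_eq_everything_map top)
  moreover have "?t 1 \<noteq> mat 1"
    using ij by (auto simp: transvection_def mat_def vec_eq_iff)
  ultimately have "\<phi> \<noteq> 0"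
    unfolding \<phi>_def using t one by (auto dest: inj_onD)
  with T \<phi>T obtain v where v: "\<phi> v \<noteq> 0" and fixed: "\<And>\<psi> :: 'v \<Rightarrow>\<^sub>L real. \<psi> (T v) = \<psi> v"
    by (metis reflexive_fixed_vector_not_annihilated[OF refl] order_refl)
  \<comment> \<open>The induction step applies \<open>fixed\<close> to the value of \<alpha> at the
    previous conjugate, so invariance of \<open>v\<close> under all functionals, not just \<phi>, is
    used.\<close>
  have pair_eq: "\<alpha> (?c (?t (real m)) y) v = \<alpha> y v" if y: "y \<in> carrier ?G" for m y
  proof (induction m)
    case 0
    then show ?case
      using G.act_one y top by (simp add: transvection_0 SL_group_def)
  next
    case (Suc m)
    have "?t (real (Suc m)) = ?t 1 \<otimes>\<^bsub>?G\<^esub> ?t (real m)"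
      using ij by (simp add: SL_group_def transvection_mult)
    then have "?c (?t (real (Suc m))) y = ?c (?t 1) (?c (?t (real m)) y)"
      using G.act_mult t y top by simp
    with Suc show ?case
      by (simp add: \<alpha>T conj_in t y fixed)
  qed
  have "continuous_on (carrier ?G) (\<lambda>y. \<alpha> y v)"
    using rep by (auto simp: is_representation_def weak_star_topology_def SL_topology_def
        continuous_on_strong_operator_topo_iff_coordinatewise)
  then have lim: "(\<lambda>m. \<alpha> (y m) v) \<longlonglongrightarrow> \<alpha> z v"
    if "y \<longlonglongrightarrow> z" "\<And>m. y m \<in> carrier ?G" "z \<in> carrier ?G" for y z
    using that by (auto intro: continuous_on_tendsto_compose)
  have "(\<lambda>m. \<alpha> (?x m) v) \<longlonglongrightarrow> \<alpha> (mat 1) v"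
    by (rule lim[OF tendsto_opposite_transvection x one])
  \<comment> \<open>By \<open>pair_eq\<close> at \<open>Suc m\<close>, the conjugates of
    \<open>?x m\<close>, which tend to \<open>?t 1\<close>, pair with \<open>v\<close> exactly as
    \<open>?x m\<close> does.\<close>
  moreover have "(\<lambda>m. \<alpha> (?x m) v) \<longlonglongrightarrow> \<alpha> (?t 1) v"
    using lim[OF tendsto_conj_opposite_transvection[OF ij] conj_in[OF t x] t]
    unfolding pair_eq[OF x] .
  ultimately have "\<alpha> (?t 1) v = \<alpha> (mat 1) v"
    by (metis LIMSEQ_unique)
  with v show False
    by (simp add: \<phi>_def blinfun.diff_left)
qed

end
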